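(* Let $c>0$ be a real number, let $n\ge k\ge 0$ be integers with $n\le k+3$, and let $G\in\mathcal{C}_n^k$. Then $$\prod\nolimits_{1,c}(G)\;\le\;\begin{cases}k^{c} & \text{if } n=k+1,\\[2pt] \left(\lceil \tfrac{k}{2}\rceil+1\right)^{c}\left(\lfloor \tfrac{k}{2}\rfloor+1\right)^{c} & \text{if } n=k+2,\\[2pt] \left(\lceil \tfrac{k}{3}\rceil+2\right)^{c}\left(\lfloor \tfrac{k}{3}\rfloor+2\right)^{c}\left(k-\lceil \tfrac{k}{3}\rceil-\lfloor \tfrac{k}{3}\rfloor+2\right)^{c} & \text{if } n=k+3.\end{cases}$$ Equality holds if and only if the degree sequence of $G$ is, respectively: $k,\underbrace{1,\dots,1}_{k}$ (case $n=k+1$); $\lceil \tfrac{k}{2}\rceil+1,\ \lfloor \tfrac{k}{2}\rfloor+1,\ \underbrace{1,\dots,1}_{k}$ (case $n=k+2$); $\lceil \tfrac{k}{3}\rceil+2,\ \lfloor \tfrac{k}{3}\rfloor+2,\ k-\lceil \tfrac{k}{3}\rceil-\lfloor \tfrac{k}{3}\rfloor+2,\ \underbrace{1,\dots,1}_{k}$ (case $n=k+3$).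
   Context: All graphs are finite, simple and connected. A cactus is a connected graph all of whose blocks are edges or cycles; equivalently, any two distinct cycles have at most one vertex in common (trees are cacti). A pendant vertex is a vertex of degree $1$. For $n\ge k\ge 0$, $\mathcal{C}_n^k$ denotes the set of cactus graphs with $n$ vertices of which exactly $k$ are pendant vertices. For $c>0$ the first (generalized) multiplicative Zagreb index is $\prod_{1,c}(G)=\prod_{v\in V(G)}d(v)^c$, where $d(v)$ is the degree of $v$. Degree sequences are considered up to order. *)

theory Defs
  imports Complex_Main "HOL-Library.Multiset" "Graph_Theory.Graph_Theory"
begin

text \<open>
  Finite simple graphs are the finite, loop-free, symmetric digraphs without parallel arcs, i.e. the
  locale predicate \<^const>\<open>graph\<close>.  Every undirected edge is a pair of opposite arcs, so the degree
  of a vertex is its \<^const>\<open>out_degree\<close>.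
\<close>

definition cut_vertex :: "('a, 'b) pre_digraph \<Rightarrow> 'a \<Rightarrow> bool" where
  "cut_vertex G v \<longleftrightarrow> v \<in> verts G \<and>
     (\<exists>u \<in> verts G - {v}. \<exists>w \<in> verts G - {v}.
        u \<rightarrow>\<^sup>*\<^bsub>G\<^esub> w \<and> \<not> u \<rightarrow>\<^sup>*\<^bsub>pre_digraph.del_vert G v\<^esub> w)"

text \<open>
  The condition \<^term>\<open>graph H\<close> restricts to undirected subgraphs: a subgraph in the sense of digraphs
  may contain an arc without its reverse.
\<close>
definition block_of :: "('a, 'b) pre_digraph \<Rightarrow> ('a, 'b) pre_digraph \<Rightarrow> bool" where
  "block_of B G \<longleftrightarrow>
     pre_digraph.max_subgraph G (\<lambda>H. graph H \<and> connected H \<and> (\<forall>v. \<not> cut_vertex H v)) B"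

text \<open>
  The bound on the length is needed because an edge traversed back and forth is a
  \<^const>\<open>pre_digraph.cycle\<close> of length 2.
\<close>
definition cycle_graph :: "('a, 'b) pre_digraph \<Rightarrow> bool" where
  "cycle_graph G \<longleftrightarrow> graph G \<and>
     (\<exists>p. pre_digraph.cycle G p \<and> 3 \<le> length p \<and>
        verts G = tail G ` set p \<and>
        arcs_ends G = arc_to_ends G ` set p \<union> (arc_to_ends G ` set p)\<inverse>)"

text \<open>
  The one-vertex graph is a tree and hence a cactus, and its only block is itself; this is the only
  connected graph with a block \<open>K\<^sub>1\<close>.
\<close>
definition cactus :: "('a, 'b) pre_digraph \<Rightarrow> bool" where
  "cactus G \<longleftrightarrow> graph G \<and> connected G \<and>
     (\<forall>B. block_of B G \<longrightarrow> K\<^bsub>1\<^esub> B \<or> K\<^bsub>2\<^esub> B \<or> cycle_graph B)"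

definition pendant_verts :: "('a, 'b) pre_digraph \<Rightarrow> 'a set" where
  "pendant_verts G = {v \<in> verts G. out_degree G v = 1}"

definition cactus_graphs :: "nat \<Rightarrow> nat \<Rightarrow> ('a, 'b) pre_digraph set" where
  "cactus_graphs n k = {G. cactus G \<and> card (verts G) = n \<and> card (pendant_verts G) = k}"

definition mult_zagreb1 :: "real \<Rightarrow> ('a, 'b) pre_digraph \<Rightarrow> real" where
  "mult_zagreb1 c G = (\<Prod>v \<in> verts G. real (out_degree G v) powr c)"

text \<open>Degree sequences up to order; integer-valued so that subtraction does not truncate.\<close>
definition degree_sequence :: "('a, 'b) pre_digraph \<Rightarrow> int multiset" where
  "degree_sequence G = image_mset (\<lambda>v. int (out_degree G v)) (mset_set (verts G))"

end

theory Submission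
  imports Defs
begin

text \<open>
  Let \<open>m = n - k\<close> be the number of non-pendant vertices.  A pendant vertex sends at most one edge into
  this set of \<open>m\<close> vertices, so the non-pendant degrees sum to at most \<open>k + m (m - 1)\<close>.  A product of
  \<open>m\<close> natural numbers with bounded sum is largest exactly when the sum is attained and the numbers
  lie in \<open>{q, q + 1}\<close> for some \<open>q\<close>: with \<open>t = (q + 1) / q\<close>, every natural number \<open>d\<close> satisfies
  \<open>d t\<^sup>q \<le> q t\<^sup>d\<close>, with equality precisely for \<open>d = q\<close> and \<open>d = q + 1\<close>, and these inequalities multiply.
\<close>

section \<open>Products of natural numbers with bounded sum\<close>

text \<open>The base \<open>t\<close> is chosen so that \<open>d / t ^ d\<close> takes equal values
  at \<open>q\<close> and \<open>q + 1\<close>. The ratio \<open>(d + 1) / d\<close> falls as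
  \<open>d\<close> grows and equals \<open>t\<close> at \<open>d = q\<close>, so the quotient rises
  strictly up to \<open>q\<close> and falls strictly from \<open>q + 1\<close> on.\<close>

lemma mult_power_ratio_le:
  fixes q d :: nat
  assumes "q \<ge> 1"
  defines "t \<equiv> (real q + 1) / real q"
  shows "real d * t ^ q \<le> real q * t ^ d"
    and "real d * t ^ q = real q * t ^ d \<longleftrightarrow> d = q \<or> d = q + 1"
proof -
  have t: "t = 1 + 1 / real q" "t > 0"
    using assms by (auto simp: t_def field_simps)
  \<comment> \<open>The offset from \<open>q\<close> starts at 2 because offsets 0 and 1 give
    equality.\<close>
  have up: "real q + real (j + 2) < real q * t ^ (j + 2)" for j
  proof (induction j)
    case 0
    show ?case
      using assms(1) by (simp add: t_def power2_eq_square field_simps)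
  next
    case (Suc j)
    have "real q + real (Suc j + 2) \<le> (real q + real (j + 2)) * t"
      using assms(1) by (simp add: t field_simps)
    also have "\<dots> < real q * t ^ (j + 2) * t"
      using Suc t(2) by (intro mult_strict_right_mono)
    finally show ?case
      by (simp add: mult_ac)
  qed
  \<comment> \<open>After division by \<open>t ^ i\<close> the right side exceeds the left by
    \<open>(i + 1) / q\<close>. Subtraction is that of the reals, so \<open>i\<close> may exceed
    \<open>q\<close>.\<close>
  have step: "(real q - real (Suc i)) * t ^ Suc i < (real q - real i) * t ^ i" for i
  proof -
    have "(real q - real (Suc i)) * t < real q - real i"
      using assms(1) by (simp add: t field_simps)
    then have "(real q - real (Suc i)) * t * t ^ i < (real q - real i) * t ^ i"
      using t(2) by (intro mult_strict_right_mono) auto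
    then show ?thesis
      by (simp add: mult_ac)
  qed
  have le: "(real q - real i) * t ^ i \<le> real q" for i
  proof (induction i)
    case (Suc i)
    then show ?case
      using step[of i] by linarith
  qed simp
  have down: "(real q - real (Suc i)) * t ^ Suc i < real q" for i
    using step[of i] le[of i] by linarith
  consider "d = q" | "d = q + 1" | j where "d = q + (j + 2)" | i where "q = d + Suc i"
  proof (cases "d < q")
    case True
    then show thesis
      using that(4) less_iff_Suc_add by auto
  next
    case False
    then obtain l where l: "d = q + l"
      by (metis le_Suc_ex not_less)
    show thesis
    proof (cases "l < 2")
      case True
      then have "l = 0 \<or> l = 1"
        by auto
      then show thesis
        using that(1,2) l by auto
    next
      case False
      then have "d = q + ((l - 2) + 2)"
        using l by simp
      then show thesis
        by (rule that(3))
    qed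
  qed
  then have "real d * t ^ q < real q * t ^ d \<or>
      (d = q \<or> d = q + 1) \<and> real d * t ^ q = real q * t ^ d"
  proof cases
    case 2
    have "real q * t = real q + 1"
      using assms(1) by (simp add: t_def)
    then show ?thesis
      using 2 by simp
  next
    case (3 j)
    have "(real q + real (j + 2)) * t ^ q < real q * t ^ (j + 2) * t ^ q"
      using up[of j] t(2) by (intro mult_strict_right_mono) auto
    then show ?thesis
      using 3 by (simp add: power_add algebra_simps)
  next
    case (4 i)
    have "(real q - real (Suc i)) * t ^ Suc i * t ^ d < real q * t ^ d"
      using down[of i] t(2) by (intro mult_strict_right_mono) auto
    then show ?thesis
      using 4 by (simp add: power_add mult_ac)
  qed simp
  moreover have "d = q \<or> d = q + 1 \<Longrightarrow> real d * t ^ q = real q * t ^ d"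
    using assms(1) by (auto simp: t_def)
  ultimately show "real d * t ^ q \<le> real q * t ^ d"
    and "real d * t ^ q = real q * t ^ d \<longleftrightarrow> d = q \<or> d = q + 1"
    using t(2) by auto
qed

text \<open>The inequalities for the single entries are multiplied. Their right sides are positive,
  so equality of the products forces equality at every entry.\<close>

lemma prod_mset_power_ratio_le:
  fixes q :: nat and M :: "nat multiset"
  assumes "q \<ge> 1"
  defines "t \<equiv> (real q + 1) / real q"
  shows "real (prod_mset M) * t ^ (q * size M) \<le> real q ^ size M * t ^ sum_mset M \<and>
    (real (prod_mset M) * t ^ (q * size M) = real q ^ size M * t ^ sum_mset M \<longleftrightarrow>
      set_mset M \<subseteq> {q, q + 1})"
proof (induction M)
  case empty
  show ?case
    by simp
next
  case (add d M)
  have t: "t > 0"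
    using assms by (auto simp: t_def)
  define a where "a = real d * t ^ q"
  define A where "A = real q * t ^ d"
  define b where "b = real (prod_mset M) * t ^ (q * size M)"
  define B where "B = real q ^ size M * t ^ sum_mset M"
  have aA: "a \<le> A" "a = A \<longleftrightarrow> d = q \<or> d = q + 1"
    unfolding a_def A_def t_def using mult_power_ratio_le[OF assms(1)] by auto
  have bB: "b \<le> B" "b = B \<longleftrightarrow> set_mset M \<subseteq> {q, q + 1}"
    using add.IH by (auto simp: b_def B_def)
  have nonneg: "0 \<le> a" "0 \<le> b"
    using t by (auto simp: a_def b_def)
  have pos: "0 < A" "0 < B"
    using t assms(1) by (auto simp: A_def B_def)
  have le: "a * b \<le> A * B"
    using aA(1) bB(1) nonneg pos by (intro mult_mono) auto
  \<comment> \<open>\<open>a\<close> and \<open>b\<close> can vanish, so the positive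
    \<open>A\<close> is cancelled first; this gives \<open>b = B\<close>, which is positive and can
    then be cancelled too.\<close>
  have eq: "a * b = A * B \<longleftrightarrow> a = A \<and> b = B"
  proof
    assume ab: "a * b = A * B"
    have "a * b \<le> A * b" "A * b \<le> A * B"
      using aA(1) bB(1) nonneg pos by (auto intro: mult_right_mono)
    with ab have "A * b = A * B" "a * b = A * b"
      by linarith+
    with pos show "a = A \<and> b = B"
      by auto
  qed simp
  have l: "real (prod_mset (add_mset d M)) * t ^ (q * size (add_mset d M)) = a * b"
    by (simp add: a_def b_def power_add mult_ac)
  have r: "real q ^ size (add_mset d M) * t ^ sum_mset (add_mset d M) = A * B"
    by (simp add: A_def B_def power_add mult_ac)
  show ?case
    unfolding l r using le eq aA(2) bB(2) by auto
qed

text \<open>The sum minus \<open>q\<close> times the size counts the entries \<open>q + 1\<close>,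
  and the size then determines the number of entries \<open>q\<close>.\<close>

lemma balanced_mset_unique:
  fixes M E :: "nat multiset"
  assumes "set_mset M \<subseteq> {q, q + 1}" "set_mset E \<subseteq> {q, q + 1}"
    and "size M = size E" "sum_mset M = sum_mset E"
  shows "M = E"
proof -
  have form: "\<exists>a b. N = replicate_mset a q + replicate_mset b (q + 1)"
    if "set_mset N \<subseteq> {q, q + 1}" for N :: "nat multiset"
    using that
  proof (induction N)
    case empty
    show ?case
      by (rule exI[of _ 0], rule exI[of _ 0]) simp
  next
    case (add d N)
    then obtain a b where N: "N = replicate_mset a q + replicate_mset b (q + 1)"
      by auto
    have "add_mset q N = replicate_mset (Suc a) q + replicate_mset b (q + 1)"
      "add_mset (q + 1) N = replicate_mset a q + replicate_mset (Suc b) (q + 1)"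
      by (simp_all add: N)
    then show ?case
      using add.prems by (metis insert_iff set_mset_add_mset_insert singletonD subset_iff)
  qed
  obtain a b a' b' where M: "M = replicate_mset a q + replicate_mset b (q + 1)"
    and E: "E = replicate_mset a' q + replicate_mset b' (q + 1)"
    using form[OF assms(1)] form[OF assms(2)] by metis
  have "a + b = a' + b'"
    using assms(3) by (simp add: M E)
  moreover have "(a + b) * q + b = (a' + b') * q + b'"
    using assms(4) by (simp add: M E algebra_simps)
  ultimately show ?thesis
    by (simp add: M E)
qed

text \<open>With \<open>s\<close> the common size, the chain is \<open>prod_mset M * T \<le> q ^ s *
  t ^ sum_mset M \<le> q ^ s * t ^ sum_mset E = prod_mset E * T\<close>. Equality in the first step
  makes \<open>M\<close> balanced, and equality in the second makes the sums agree because
  \<open>t > 1\<close>.\<close>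

lemma prod_mset_le_balanced:
  fixes M E :: "nat multiset"
  assumes "q \<ge> 1" "set_mset E \<subseteq> {q, q + 1}" "size M = size E" "sum_mset M \<le> sum_mset E"
  shows "prod_mset M \<le> prod_mset E"
    and "prod_mset M = prod_mset E \<longleftrightarrow> M = E"
proof -
  define t where "t = (real q + 1) / real q"
  have t: "t > 1"
    using assms(1) by (simp add: t_def)
  define T where "T = t ^ (q * size E)"
  have T: "T > 0"
    using t by (simp add: T_def)
  note M = prod_mset_power_ratio_le[OF assms(1), of M, folded t_def, unfolded assms(3), folded T_def]
  have E: "real (prod_mset E) * T = real q ^ size E * t ^ sum_mset E"
    using prod_mset_power_ratio_le[OF assms(1), of E] assms(2) by (auto simp: t_def T_def)
  have mono: "real q ^ size E * t ^ sum_mset M \<le> real q ^ size E * t ^ sum_mset E"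
    using assms(4) t by (intro mult_left_mono power_increasing) auto
  have "real (prod_mset M) * T \<le> real (prod_mset E) * T"
    using M mono E by linarith
  then show "prod_mset M \<le> prod_mset E"
    using T by simp
  show "prod_mset M = prod_mset E \<longleftrightarrow> M = E"
  proof
    assume "prod_mset M = prod_mset E"
    then have "real (prod_mset M) * T = real (prod_mset E) * T"
      by simp
    then have *: "real (prod_mset M) * T = real q ^ size E * t ^ sum_mset M"
      and **: "real q ^ size E * t ^ sum_mset M = real q ^ size E * t ^ sum_mset E"
      using M mono E by (linarith, linarith)
    from * have "set_mset M \<subseteq> {q, q + 1}"
      using M by blast
    moreover have "sum_mset M = sum_mset E"
      using ** t assms(1) by simp
    ultimately show "M = E"
      using assms(2,3) by (intro balanced_mset_unique)
  qed simp
qed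

section \<open>Non-pendant degrees\<close>

text \<open>Without parallel arcs, an arc is determined by its pair of ends. Counting such pairs
  makes reversal of arcs a plain converse of relations.\<close>

lemma (in nomulti_digraph) sum_out_degree:
  assumes "finite (arcs G)" "finite S"
  shows "(\<Sum>v\<in>S. out_degree G v) = card (arcs_ends G \<inter> S \<times> UNIV)"
proof -
  have "(\<Sum>v\<in>S. out_degree G v) = card (\<Union>v\<in>S. out_arcs G v)"
    unfolding out_degree_def using assms
    by (intro card_UN_disjoint[symmetric]) (auto simp: out_arcs_def)
  also have "\<dots> = card (arc_to_ends G ` (\<Union>v\<in>S. out_arcs G v))"
    by (intro card_image[symmetric] inj_on_subset[OF inj_on_arc_to_ends]) auto
  also have "arc_to_ends G ` (\<Union>v\<in>S. out_arcs G v) = arcs_ends G \<inter> S \<times> UNIV"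
    by (auto simp: arcs_ends_def arc_to_ends_def)
  finally show ?thesis .
qed

lemma (in graph) sum_out_degree_le:
  assumes "S \<subseteq> verts G"
  shows "(\<Sum>v\<in>S. out_degree G v) \<le>
    card S * (card S - 1) + (\<Sum>v\<in>verts G - S. out_degree G v)"
proof -
  have fin: "finite S" "finite (arcs_ends G)"
    using finite_subset[OF assms] by (auto simp: arcs_ends_def)
  \<comment> \<open>An arc leaving a vertex of \<open>S\<close> either joins two distinct vertices
    of \<open>S\<close> or is the reverse of an arc that starts outside \<open>S\<close>.\<close>
  have "arcs_ends G \<inter> S \<times> UNIV \<subseteq> (S \<times> S - Id_on S) \<union> (arcs_ends G \<inter> (verts G - S) \<times> UNIV)\<inverse>"
    using adj_in_verts arcs_ends_symmetric[OF sym_arcs] adj_not_same by auto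
  then have "card (arcs_ends G \<inter> S \<times> UNIV) \<le>
      card ((S \<times> S - Id_on S) \<union> (arcs_ends G \<inter> (verts G - S) \<times> UNIV)\<inverse>)"
    using fin by (intro card_mono) auto
  also have "\<dots> \<le> card (S \<times> S - Id_on S) + card ((arcs_ends G \<inter> (verts G - S) \<times> UNIV)\<inverse>)"
    by (rule card_Un_le)
  also have "card (S \<times> S - Id_on S) = card S * (card S - 1)"
  proof -
    have "Id_on S = (\<lambda>x. (x, x)) ` S"
      by auto
    then have "card (Id_on S) = card S" "Id_on S \<subseteq> S \<times> S" "finite (Id_on S)"
      using fin by (auto simp: card_image inj_on_def)
    then show ?thesis
      by (simp add: card_Diff_subset card_cartesian_product diff_mult_distrib2)
  qed
  finally show ?thesis
    using fin by (simp add: sum_out_degree)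
qed

definition inner_degrees :: "('a, 'b) pre_digraph \<Rightarrow> nat multiset" where
  "inner_degrees G = image_mset (out_degree G) (mset_set (verts G - pendant_verts G))"

context
  fixes G :: "('a, 'b) pre_digraph" and n k :: nat
  assumes G: "G \<in> cactus_graphs n k"
begin

interpretation graph G
  using G by (simp add: cactus_graphs_def cactus_def)

lemma card_pendant_verts: "card (pendant_verts G) = k"
  using G by (simp add: cactus_graphs_def)

lemma pendant_verts_subset: "pendant_verts G \<subseteq> verts G"
  by (auto simp: pendant_verts_def)

lemma finite_pendant_verts: "finite (pendant_verts G)"
  using finite_verts pendant_verts_subset by (rule rev_finite_subset)

lemma card_inner_verts: "card (verts G - pendant_verts G) = n - k"
  using G pendant_verts_subset finite_pendant_verts
  by (simp add: card_Diff_subset cactus_graphs_def)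

lemma size_inner_degrees: "size (inner_degrees G) = n - k"
  by (simp add: inner_degrees_def card_inner_verts)

lemma sum_inner_degrees_le: "sum_mset (inner_degrees G) \<le> (n - k) * (n - k - 1) + k"
proof -
  have "verts G - (verts G - pendant_verts G) = pendant_verts G"
    using pendant_verts_subset by auto
  moreover have "(\<Sum>v\<in>pendant_verts G. out_degree G v) = k"
    using card_pendant_verts by (simp add: pendant_verts_def)
  ultimately show ?thesis
    using sum_out_degree_le[of "verts G - pendant_verts G"] card_inner_verts
    by (simp add: inner_degrees_def sum_unfold_sum_mset)
qed

lemma degree_sequence_conv_inner_degrees:
  "degree_sequence G = image_mset int (inner_degrees G) + replicate_mset k 1"
proof -
  have "mset_set (verts G) = mset_set (verts G - pendant_verts G) + mset_set (pendant_verts G)"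
    using pendant_verts_subset finite_pendant_verts
    by (subst mset_set_Union[symmetric]) (auto intro: arg_cong[where f = mset_set])
  moreover have "image_mset (\<lambda>v. int (out_degree G v)) (mset_set (pendant_verts G)) =
      image_mset (\<lambda>v. 1) (mset_set (pendant_verts G))"
    using finite_pendant_verts by (intro image_mset_cong) (simp add: pendant_verts_def)
  ultimately show ?thesis
    by (simp add: degree_sequence_def inner_degrees_def multiset.map_comp comp_def
        image_mset_const_eq card_pendant_verts)
qed

text \<open>Cancels the pendant ones and the injective embedding \<open>int\<close>, so that
  equality cases can be decided for multisets of natural numbers.\<close>

lemma degree_sequence_eq_iff:
  "degree_sequence G = image_mset int E + replicate_mset k 1 \<longleftrightarrow> inner_degrees G = E"
proof -
  have "inj (image_mset int)"
    by (intro multiset.inj_map inj_of_nat)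
  then show ?thesis
    unfolding degree_sequence_conv_inner_degrees by (auto dest: injD)
qed

lemma mult_zagreb1_conv_inner_degrees:
  "mult_zagreb1 c G = real (prod_mset (inner_degrees G)) powr c"
proof -
  have "mult_zagreb1 c G = (\<Prod>v\<in>verts G - pendant_verts G. real (out_degree G v) powr c)"
    unfolding mult_zagreb1_def
    by (intro prod.mono_neutral_right) (auto simp: pendant_verts_def)
  also have "\<dots> = real (\<Prod>v\<in>verts G - pendant_verts G. out_degree G v) powr c"
    by (simp add: prod_powr_distrib)
  finally show ?thesis
    by (simp add: inner_degrees_def prod_unfold_prod_mset)
qed

text \<open>Each case of the theorem reduces to exhibiting a balanced \<open>E\<close> of the right
  size that attains the bound on the sum of the non-pendant degrees.\<close>

lemma mult_zagreb1_le_balanced: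
  assumes "c > 0" "q \<ge> 1" "set_mset E \<subseteq> {q, q + 1}" "size E = n - k"
    and "sum_mset E = (n - k) * (n - k - 1) + k"
  shows "mult_zagreb1 c G \<le> real (prod_mset E) powr c"
    and "mult_zagreb1 c G = real (prod_mset E) powr c \<longleftrightarrow>
      degree_sequence G = image_mset int E + replicate_mset k 1"
proof -
  note bal = prod_mset_le_balanced[OF assms(2,3), of "inner_degrees G"]
  have "prod_mset (inner_degrees G) \<le> prod_mset E"
    and eq: "prod_mset (inner_degrees G) = prod_mset E \<longleftrightarrow> inner_degrees G = E"
    using bal size_inner_degrees sum_inner_degrees_le assms(4,5) by auto
  then show "mult_zagreb1 c G \<le> real (prod_mset E) powr c"
    using assms(1) unfolding mult_zagreb1_conv_inner_degrees by (intro powr_mono2) auto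
  \<comment> \<open>For \<open>c > 0\<close> the power is strictly increasing on nonnegative reals,
    hence injective there.\<close>
  have "real a powr c = real b powr c \<longleftrightarrow> a = b" for a b :: nat
    using assms(1) powr_less_mono2[of c "real a" "real b"] powr_less_mono2[of c "real b" "real a"]
    by (cases a b rule: linorder_cases) auto
  then show "mult_zagreb1 c G = real (prod_mset E) powr c \<longleftrightarrow>
      degree_sequence G = image_mset int E + replicate_mset k 1"
    unfolding degree_sequence_eq_iff mult_zagreb1_conv_inner_degrees eq[symmetric] by simp
qed

end

section \<open>The cases of one, two and three non-pendant vertices\<close>

theorem theorem2:
  fixes c :: real and n k :: nat and G :: "('a, 'b) pre_digraph"
  assumes "c > 0"
    and "k \<le> n"
    and "n \<le> k + 3"
    and "G \<in> cactus_graphs n k"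
  shows
    "(n = k + 1 \<longrightarrow>
        mult_zagreb1 c G \<le> real k powr c \<and>
        (mult_zagreb1 c G = real k powr c \<longleftrightarrow>
           degree_sequence G = {#int k#} + replicate_mset k 1)) \<and>
     (n = k + 2 \<longrightarrow>
        mult_zagreb1 c G \<le>
          real_of_int (\<lceil>real k / 2\<rceil> + 1) powr c * real_of_int (\<lfloor>real k / 2\<rfloor> + 1) powr c \<and>
        (mult_zagreb1 c G =
          real_of_int (\<lceil>real k / 2\<rceil> + 1) powr c * real_of_int (\<lfloor>real k / 2\<rfloor> + 1) powr c \<longleftrightarrow>
           degree_sequence G =
             {#\<lceil>real k / 2\<rceil> + 1, \<lfloor>real k / 2\<rfloor> + 1#} + replicate_mset k 1)) \<and>
     (n = k + 3 \<longrightarrow>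
        mult_zagreb1 c G \<le>
          real_of_int (\<lceil>real k / 3\<rceil> + 2) powr c * real_of_int (\<lfloor>real k / 3\<rfloor> + 2) powr c *
          real_of_int (int k - \<lceil>real k / 3\<rceil> - \<lfloor>real k / 3\<rfloor> + 2) powr c \<and>
        (mult_zagreb1 c G =
          real_of_int (\<lceil>real k / 3\<rceil> + 2) powr c * real_of_int (\<lfloor>real k / 3\<rfloor> + 2) powr c *
          real_of_int (int k - \<lceil>real k / 3\<rceil> - \<lfloor>real k / 3\<rfloor> + 2) powr c \<longleftrightarrow>
           degree_sequence G =
             {#\<lceil>real k / 3\<rceil> + 2, \<lfloor>real k / 3\<rfloor> + 2,
               int k - \<lceil>real k / 3\<rceil> - \<lfloor>real k / 3\<rfloor> + 2#} + replicate_mset k 1))"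
proof -
  note bound = mult_zagreb1_le_balanced[OF assms(4,1)]
  have 1: "mult_zagreb1 c G \<le> real k powr c \<and>
      (mult_zagreb1 c G = real k powr c \<longleftrightarrow>
        degree_sequence G = {#int k#} + replicate_mset k 1)" if n: "n = k + 1"
  \<comment> \<open>For \<open>k = 0\<close> the balanced value would be \<open>q = 0\<close>, which
    the general bound excludes. The graph is then a single vertex of degree 0, and both sides are
    \<open>0 powr c\<close>.\<close>
  proof (cases "k = 0")
    case True
    obtain d where "inner_degrees G = {#d#}"
      using size_inner_degrees[OF assms(4)] n size_1_singleton_mset by fastforce
    then have "inner_degrees G = {#0#}"
      using sum_inner_degrees_le[OF assms(4)] n True by simp
    then show ?thesis
      using True mult_zagreb1_conv_inner_degrees[OF assms(4), of c]
        degree_sequence_conv_inner_degrees[OF assms(4)] by simp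
  next
    case False
    then show ?thesis
      using bound[of k "{#k#}"] n by simp
  qed
  have 2: "mult_zagreb1 c G \<le>
        real_of_int (\<lceil>real k / 2\<rceil> + 1) powr c * real_of_int (\<lfloor>real k / 2\<rfloor> + 1) powr c \<and>
      (mult_zagreb1 c G =
        real_of_int (\<lceil>real k / 2\<rceil> + 1) powr c * real_of_int (\<lfloor>real k / 2\<rfloor> + 1) powr c \<longleftrightarrow>
        degree_sequence G =
          {#\<lceil>real k / 2\<rceil> + 1, \<lfloor>real k / 2\<rfloor> + 1#} + replicate_mset k 1)" if n: "n = k + 2"
  proof -
    \<comment> \<open>The two roundings of \<open>k / 2\<close> as natural numbers. The required sum
      is \<open>2 * 1 + k\<close>, and \<open>y\<close> serves as \<open>q\<close>.\<close>
    define x y where "x = (k + 1) div 2 + 1" and "y = k div 2 + 1"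
    have xy: "\<lceil>real k / 2\<rceil> + 1 = int x" "\<lfloor>real k / 2\<rfloor> + 1 = int y"
      unfolding x_def y_def by linarith+
    have "x + y = k + 2" "x = y \<or> x = y + 1" "y \<ge> 1"
      unfolding x_def y_def by presburger+
    then have "y \<ge> 1" "set_mset {#x, y#} \<subseteq> {y, y + 1}" "size {#x, y#} = n - k"
      "sum_mset {#x, y#} = (n - k) * (n - k - 1) + k"
      using n by auto
    note bound[OF this]
    then show ?thesis
      unfolding xy by (simp add: powr_mult)
  qed
  have 3: "mult_zagreb1 c G \<le>
        real_of_int (\<lceil>real k / 3\<rceil> + 2) powr c * real_of_int (\<lfloor>real k / 3\<rfloor> + 2) powr c *
        real_of_int (int k - \<lceil>real k / 3\<rceil> - \<lfloor>real k / 3\<rfloor> + 2) powr c \<and>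
      (mult_zagreb1 c G =
        real_of_int (\<lceil>real k / 3\<rceil> + 2) powr c * real_of_int (\<lfloor>real k / 3\<rfloor> + 2) powr c *
        real_of_int (int k - \<lceil>real k / 3\<rceil> - \<lfloor>real k / 3\<rfloor> + 2) powr c \<longleftrightarrow>
        degree_sequence G =
          {#\<lceil>real k / 3\<rceil> + 2, \<lfloor>real k / 3\<rfloor> + 2,
            int k - \<lceil>real k / 3\<rceil> - \<lfloor>real k / 3\<rfloor> + 2#} + replicate_mset k 1)" if n: "n = k + 3"
  proof -
    \<comment> \<open>\<open>k div 3\<close>, \<open>(k + 1) div 3\<close> and
      \<open>(k + 2) div 3\<close> add up to \<open>k\<close> and differ by at most 1. So
      \<open>z\<close> is the third degree of the statement, left over from the ceiling and the
      floor, and the sum is the required \<open>3 * 2 + k\<close>.\<close>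
    define x y z where "x = (k + 2) div 3 + 2" and "y = k div 3 + 2" and "z = (k + 1) div 3 + 2"
    have xy: "\<lceil>real k / 3\<rceil> + 2 = int x" "\<lfloor>real k / 3\<rfloor> + 2 = int y"
      unfolding x_def y_def by linarith+
    have sum: "x + y + z = k + 6" and "x = y \<or> x = y + 1" "z = y \<or> z = y + 1" "y \<ge> 1"
      unfolding x_def y_def z_def by (linarith | presburger)+
    then have balanced: "y \<ge> 1" "set_mset {#x, y, z#} \<subseteq> {y, y + 1}" "size {#x, y, z#} = n - k"
      "sum_mset {#x, y, z#} = (n - k) * (n - k - 1) + k"
      using n by auto
    have z: "int k - \<lceil>real k / 3\<rceil> - \<lfloor>real k / 3\<rfloor> + 2 = int z"
      using xy sum by linarith
    note bound[OF balanced]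
    then show ?thesis
      unfolding xy z by (simp add: powr_mult mult_ac)
  qed
  from 1 2 3 show ?thesis
    by blast
qed

end
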